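(* Let $\theta\in\mathbb{R}$ with $|\theta|<\pi/2$ and let $\gamma>0$. If $f=h+\overline{g}\in\mathcal{HC}_\theta(\gamma)$, then the Schwarzian norm of $f$ satisfies $$\Vert S_f\Vert\le 2\gamma\cos\theta\,\sqrt{4+(\gamma^2+4\gamma)\cos^2\theta}+2\gamma\cos\theta+\frac{11}{2}.$$
   Context: $\mathbb{D}=\{z\in\mathbb{C}:|z|<1\}$. $\operatorname{Aut}(\mathbb{D})=\{e^{i\phi}\frac{z-\alpha}{1-\overline{\alpha}z}:\alpha\in\mathbb{D},\ \phi\in\mathbb{R}\}$ is the set of automorphisms of $\mathbb{D}$. $\mathcal{H}$ is the class of harmonic mappings $f=h+\overline{g}$ in $\mathbb{D}$, with $h,g$ analytic in $\mathbb{D}$ and $h(0)=h'(0)-1=g(0)=0$. For $|\theta|<\pi/2$ and $\gamma>0$, $\mathcal{HC}_\theta(\gamma)$ is the class of all $f=h+\overline{g}\in\mathcal{H}$ (with $h'$ non-vanishing in $\mathbb{D}$) such that $$\operatorname{Re}\left(e^{i\theta}\left(1+\frac{zh''(z)}{h'(z)}\right)\right)<\left(1+\frac{\gamma}{2}\right)\cos\theta\quad\text{for all } z\in\mathbb{D}$$ and the dilatation $\omega=g'/h'$ belongs to $\operatorname{Aut}(\mathbb{D})$. The Schwarzian derivative of such $f$ is $$S_f=(\log J_f)_{zz}-\frac12\left((\log J_f)_z\right)^2=S_h+\frac{\overline{\omega}}{1-|\omega|^2}\left(\frac{h''}{h'}\omega'-\omega''\right)-\frac32\left(\frac{\omega'\overline{\omega}}{1-|\omega|^2}\right)^2,$$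 where $J_f=|h'|^2-|g'|^2$ and $S_h=\left(\frac{h''}{h'}\right)'-\frac12\left(\frac{h''}{h'}\right)^2$. The Schwarzian norm is $\Vert S_f\Vert=\sup_{z\in\mathbb{D}}(1-|z|^2)^2|S_f(z)|$. *)

theory Defs
  imports "HOL-Complex_Analysis.Riemann_Mapping"
begin

abbreviation unit_disk :: "complex set" where
  "unit_disk \<equiv> ball 0 1"

text \<open>Wirtinger derivatives of \<open>F = F(x + \<i> y)\<close>:
  \<open>F\<^sub>z = (F\<^sub>x - \<i> F\<^sub>y) / 2\<close> and its conjugate counterpart, where \<open>F\<^sub>x\<close> and \<open>F\<^sub>y\<close> are the values
  of the real Frechet derivative in the directions \<open>1\<close> and \<open>\<i>\<close>.\<close>

definition wirtinger :: "(complex \<Rightarrow> complex) \<Rightarrow> complex \<Rightarrow> complex" where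
  "wirtinger F z =
     (frechet_derivative F (at z) 1 - \<i> * frechet_derivative F (at z) \<i>) / 2"

definition wirtinger_bar :: "(complex \<Rightarrow> complex) \<Rightarrow> complex \<Rightarrow> complex" where
  "wirtinger_bar F z =
     (frechet_derivative F (at z) 1 + \<i> * frechet_derivative F (at z) \<i>) / 2"

text \<open>The Jacobian determinant of \<open>f\<close>; for \<open>f = h + cnj g\<close> it is \<open>|h'|\<^sup>2 - |g'|\<^sup>2\<close>, see
  \<open>jacobian_eq\<close> below. The definition only uses \<open>f\<close> itself, as do the two that follow.\<close>

definition jacobian :: "(complex \<Rightarrow> complex) \<Rightarrow> complex \<Rightarrow> real" where
  "jacobian f z = (cmod (wirtinger f z))\<^sup>2 - (cmod (wirtinger_bar f z))\<^sup>2"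

definition schwarzian :: "(complex \<Rightarrow> complex) \<Rightarrow> complex \<Rightarrow> complex" where
  "schwarzian f z =
     (let L = (\<lambda>w. complex_of_real (ln (jacobian f w)))
      in wirtinger (wirtinger L) z - (wirtinger L z)\<^sup>2 / 2)"

text \<open>The supremum is taken in the extended reals, so that a bound on it includes its finiteness.\<close>

definition schwarzian_norm :: "(complex \<Rightarrow> complex) \<Rightarrow> ereal" where
  "schwarzian_norm f =
     (SUP z\<in>unit_disk. ereal ((1 - (cmod z)\<^sup>2)\<^sup>2 * cmod (schwarzian f z)))"

text \<open>\<open>f\<close> is the normalised harmonic mapping of the disk with analytic part \<open>h\<close> and co-analytic
  part \<open>g\<close>. Values outside the disk are irrelevant.\<close>

definition harmonic_decomp ::
  "(complex \<Rightarrow> complex) \<Rightarrow> (complex \<Rightarrow> complex) \<Rightarrow> (complex \<Rightarrow> complex) \<Rightarrow> bool" where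
  "harmonic_decomp f h g \<longleftrightarrow>
     h holomorphic_on unit_disk \<and> g holomorphic_on unit_disk \<and>
     h 0 = 0 \<and> deriv h 0 = 1 \<and> g 0 = 0 \<and>
     (\<forall>z\<in>unit_disk. f z = h z + cnj (g z))"

text \<open>Functions that agree on the disk with \<open>z \<mapsto> e\<^bsup>\<i>\<phi>\<^esup> (z - \<alpha>) / (1 - cnj \<alpha> z)\<close>.\<close>

definition disk_automorphisms :: "(complex \<Rightarrow> complex) set" where
  "disk_automorphisms =
     {w. \<exists>\<alpha>\<in>unit_disk. \<exists>\<phi>::real. \<forall>z\<in>unit_disk. w z = Moebius_function \<phi> \<alpha> z}"

definition HC :: "real \<Rightarrow> real \<Rightarrow> (complex \<Rightarrow> complex) set" where
  "HC \<theta> \<gamma> =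
     {f. \<exists>h g. harmonic_decomp f h g \<and>
           (\<forall>z\<in>unit_disk. deriv h z \<noteq> 0) \<and>
           (\<forall>z\<in>unit_disk.
              Re (exp (\<i> * of_real \<theta>) * (1 + z * deriv (deriv h) z / deriv h z))
                < (1 + \<gamma> / 2) * cos \<theta>) \<and>
           (\<lambda>z. deriv g z / deriv h z) \<in> disk_automorphisms}"


subsection \<open>The closed forms of the Jacobian and of the Schwarzian derivative\<close>

definition has_wirtinger ::
  "(complex \<Rightarrow> complex) \<Rightarrow> complex \<Rightarrow> complex \<Rightarrow> complex \<Rightarrow> bool" where
  "has_wirtinger F a b z \<longleftrightarrow> (F has_derivative (\<lambda>v. a * v + b * cnj v)) (at z)"

lemma has_wirtinger_imp:
  assumes "has_wirtinger F a b z"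
  shows "wirtinger F z = a" "wirtinger_bar F z = b"
proof -
  have "frechet_derivative F (at z) = (\<lambda>v. a * v + b * cnj v)"
    using frechet_derivative_at[OF assms[unfolded has_wirtinger_def]] by simp
  then show "wirtinger F z = a" "wirtinger_bar F z = b"
    by (simp_all add: wirtinger_def wirtinger_bar_def algebra_simps)
qed

lemma has_wirtinger_field:
  assumes "(F has_field_derivative a) (at z)"
  shows "has_wirtinger F a 0 z"
  using assms by (simp add: has_wirtinger_def has_field_derivative_def)

lemma has_wirtinger_cnj:
  assumes "has_wirtinger F a b z"
  shows "has_wirtinger (\<lambda>w. cnj (F w)) (cnj b) (cnj a) z"
  using has_derivative_cnj[OF assms[unfolded has_wirtinger_def]]
  by (simp add: has_wirtinger_def add.commute)

lemma has_wirtinger_add: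
  assumes "has_wirtinger F a b z" "has_wirtinger G c d z"
  shows "has_wirtinger (\<lambda>w. F w + G w) (a + c) (b + d) z"
  using has_derivative_add[OF assms[unfolded has_wirtinger_def]]
  by (simp add: has_wirtinger_def algebra_simps)

lemma has_wirtinger_diff:
  assumes "has_wirtinger F a b z" "has_wirtinger G c d z"
  shows "has_wirtinger (\<lambda>w. F w - G w) (a - c) (b - d) z"
  using has_derivative_diff[OF assms[unfolded has_wirtinger_def]]
  by (simp add: has_wirtinger_def algebra_simps)

lemma has_wirtinger_mult:
  assumes "has_wirtinger F a b z" "has_wirtinger G c d z"
  shows "has_wirtinger (\<lambda>w. F w * G w) (F z * c + a * G z) (F z * d + b * G z) z"
  using has_derivative_mult[OF assms[unfolded has_wirtinger_def]]
  by (simp add: has_wirtinger_def algebra_simps)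

lemma has_wirtinger_compose:
  assumes "has_wirtinger F a b z" "(G has_field_derivative c) (at (F z))"
  shows "has_wirtinger (\<lambda>w. G (F w)) (c * a) (c * b) z"
  using has_derivative_compose[OF assms(1)[unfolded has_wirtinger_def]
      assms(2)[unfolded has_field_derivative_def]]
  by (simp add: has_wirtinger_def algebra_simps)

lemma has_wirtinger_transform:
  assumes "has_wirtinger F a b z" "z \<in> unit_disk" "\<And>w. w \<in> unit_disk \<Longrightarrow> F w = G w"
  shows "has_wirtinger G a b z"
  using has_derivative_transform_within_open[OF assms(1)[unfolded has_wirtinger_def] open_ball assms(2)]
    assms(3) by (simp add: has_wirtinger_def)

lemma jacobian_eq:
  assumes "harmonic_decomp f h g" "z \<in> unit_disk"
  shows "jacobian f z = (cmod (deriv h z))\<^sup>2 - (cmod (deriv g z))\<^sup>2"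
proof -
  have h: "has_wirtinger h (deriv h z) 0 z" and g: "has_wirtinger g (deriv g z) 0 z"
    using assms unfolding harmonic_decomp_def
    by (auto intro!: has_wirtinger_field holomorphic_derivI[OF _ open_ball])
  have "has_wirtinger (\<lambda>w. h w + cnj (g w)) (deriv h z) (cnj (deriv g z)) z"
    using has_wirtinger_add[OF h has_wirtinger_cnj[OF g]] by simp
  then have "has_wirtinger f (deriv h z) (cnj (deriv g z)) z"
    using assms by (elim has_wirtinger_transform) (auto simp: harmonic_decomp_def)
  then show ?thesis
    by (simp add: jacobian_def has_wirtinger_imp)
qed

lemma schwarzian_eq:
  fixes f h g \<omega> :: "complex \<Rightarrow> complex"
  assumes dec: "harmonic_decomp f h g"
    and h_nz: "\<And>z. z \<in> unit_disk \<Longrightarrow> deriv h z \<noteq> 0"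
    and \<omega>: "\<And>z. \<omega> z = deriv g z / deriv h z"
    and \<omega>_less: "\<And>z. z \<in> unit_disk \<Longrightarrow> cmod (\<omega> z) < 1"
    and z: "z \<in> unit_disk"
  defines "P \<equiv> \<lambda>z. deriv (deriv h) z / deriv h z"
  shows "schwarzian f z =
     (deriv P z - (P z)\<^sup>2 / 2)
     + cnj (\<omega> z) / of_real (1 - (cmod (\<omega> z))\<^sup>2) * (P z * deriv \<omega> z - deriv (deriv \<omega>) z)
     - 3 / 2 * (deriv \<omega> z * cnj (\<omega> z) / of_real (1 - (cmod (\<omega> z))\<^sup>2))\<^sup>2"
proof -
  have hh: "h holomorphic_on unit_disk" and hg: "g holomorphic_on unit_disk"
    using dec by (auto simp: harmonic_decomp_def)
  have hol: "deriv h holomorphic_on unit_disk" "deriv g holomorphic_on unit_disk"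
    using hh hg by (auto intro: holomorphic_deriv)
  have hol2: "deriv (deriv h) holomorphic_on unit_disk"
    using hol by (auto intro: holomorphic_deriv)
  have \<omega>h: "\<omega> holomorphic_on unit_disk"
  proof -
    have "(\<lambda>z. deriv g z / deriv h z) holomorphic_on unit_disk"
      using hol h_nz by (intro holomorphic_on_divide) auto
    moreover have "\<omega> = (\<lambda>z. deriv g z / deriv h z)" using \<omega> by auto
    ultimately show ?thesis by simp
  qed
  have Ph: "P holomorphic_on unit_disk"
    unfolding P_def using hol hol2 h_nz by (intro holomorphic_on_divide) auto
  have \<omega>h1: "deriv \<omega> holomorphic_on unit_disk"
    using \<omega>h by (auto intro: holomorphic_deriv)
  note DI = has_wirtinger_field[OF holomorphic_derivI[OF _ open_ball]]
  define k where "k = (\<lambda>w. 1 - \<omega> w * cnj (\<omega> w))"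
  have k_real: "k w = of_real (1 - (cmod (\<omega> w))\<^sup>2)" for w
    by (simp add: k_def complex_norm_square del: of_real_power)
  have k_nz: "k w \<noteq> 0" and k_pos: "0 < 1 - (cmod (\<omega> w))\<^sup>2" if "w \<in> unit_disk" for w
  proof -
    show "0 < 1 - (cmod (\<omega> w))\<^sup>2" using \<omega>_less[OF that] by (simp add: power_less_one_iff)
    then show "k w \<noteq> 0" unfolding k_real of_real_eq_0_iff by linarith
  qed
  have Dk: "has_wirtinger k (- deriv \<omega> w * cnj (\<omega> w)) (- \<omega> w * cnj (deriv \<omega> w)) w"
    if "w \<in> unit_disk" for w
    using has_wirtinger_diff[OF has_wirtinger_field[OF DERIV_const[of 1]]
        has_wirtinger_mult[OF DI[OF \<omega>h that] has_wirtinger_cnj[OF DI[OF \<omega>h that]]]]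
    by (simp add: k_def)
  define L where "L = (\<lambda>w. complex_of_real (ln (jacobian f w)))"
  define J where "J = (\<lambda>w. deriv h w * cnj (deriv h w) * k w)"
  have J_real: "J w = of_real (jacobian f w)" and J_pos: "0 < jacobian f w"
    if w: "w \<in> unit_disk" for w
  proof -
    have "deriv g w = \<omega> w * deriv h w" using \<omega> h_nz[OF w] by simp
    then have *: "jacobian f w = (cmod (deriv h w))\<^sup>2 * (1 - (cmod (\<omega> w))\<^sup>2)"
      using jacobian_eq[OF dec w] by (simp add: norm_mult power_mult_distrib algebra_simps)
    show "0 < jacobian f w" unfolding * using h_nz[OF w] k_pos[OF w] by simp
    show "J w = of_real (jacobian f w)"
      unfolding * J_def of_real_mult k_real complex_norm_square by simp
  qed
  have DL: "has_wirtinger L (P w - deriv \<omega> w * cnj (\<omega> w) / k w)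
      (cnj (P w) - \<omega> w * cnj (deriv \<omega> w) / k w) w" if w: "w \<in> unit_disk" for w
  proof -
    note DJ = has_wirtinger_mult[OF has_wirtinger_mult[OF DI[OF hol(1) w]
          has_wirtinger_cnj[OF DI[OF hol(1) w]]] Dk[OF w], folded J_def]
    have "J w \<notin> \<real>\<^sub>\<le>\<^sub>0"
      using J_pos[OF w] by (simp add: J_real[OF w])
    then have DLn: "(Ln has_field_derivative inverse (J w)) (at (J w))"
      by (intro has_field_derivative_Ln)
    note * = has_wirtinger_compose[OF DJ DLn]
    have e1: "inverse (J w) * ((deriv h w * cnj (deriv h w)) * (- deriv \<omega> w * cnj (\<omega> w))
        + (deriv h w * 0 + deriv (deriv h) w * cnj (deriv h w)) * k w)
        = P w - deriv \<omega> w * cnj (\<omega> w) / k w"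
      using h_nz[OF w] k_nz[OF w] by (simp add: P_def J_def field_simps)
    have e2: "inverse (J w) * ((deriv h w * cnj (deriv h w)) * (- \<omega> w * cnj (deriv \<omega> w))
        + (deriv h w * cnj (deriv (deriv h) w) + 0 * cnj (deriv h w)) * k w)
        = cnj (P w) - \<omega> w * cnj (deriv \<omega> w) / k w"
      using h_nz[OF w] k_nz[OF w] by (simp add: P_def J_def field_simps)
    have "has_wirtinger (\<lambda>w. Ln (J w)) (P w - deriv \<omega> w * cnj (\<omega> w) / k w)
      (cnj (P w) - \<omega> w * cnj (deriv \<omega> w) / k w) w"
      unfolding e1[symmetric] e2[symmetric] using * by simp
    then show ?thesis
      using w by (elim has_wirtinger_transform) (simp_all add: L_def J_real J_pos Ln_of_real)
  qed
  define A where "A = (\<lambda>w. P w - deriv \<omega> w * cnj (\<omega> w) * inverse (k w))"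
  have A: "wirtinger L w = A w" if "w \<in> unit_disk" for w
    using has_wirtinger_imp(1)[OF DL[OF that]] by (simp add: A_def divide_inverse)
  have Dinv: "(inverse has_field_derivative - inverse ((k z)\<^sup>2)) (at (k z))"
    using DERIV_inverse[OF k_nz[OF z]] by (simp add: power2_eq_square)
  note DA = has_wirtinger_diff[OF DI[OF Ph z] has_wirtinger_mult[OF has_wirtinger_mult[OF
        DI[OF \<omega>h1 z] has_wirtinger_cnj[OF DI[OF \<omega>h z]]] has_wirtinger_compose[OF Dk[OF z] Dinv]],
      folded A_def]
  have transfer_A: "has_wirtinger (wirtinger L) a b z" if "has_wirtinger A a b z" for a b
    using has_wirtinger_transform[OF that z] A by simp
  note DA' = transfer_A[OF DA]
  have "wirtinger (wirtinger L) z = deriv P z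
      - (deriv (deriv \<omega>) z * cnj (\<omega> z) * inverse (k z)
         + (deriv \<omega> z * cnj (\<omega> z))\<^sup>2 * inverse ((k z)\<^sup>2))"
    unfolding has_wirtinger_imp(1)[OF DA'] by (simp add: power2_eq_square algebra_simps)
  then have "schwarzian f z = deriv P z
      - (deriv (deriv \<omega>) z * cnj (\<omega> z) * inverse (k z)
         + (deriv \<omega> z * cnj (\<omega> z))\<^sup>2 * inverse ((k z)\<^sup>2)) - (A z)\<^sup>2 / 2"
    unfolding schwarzian_def Let_def L_def[symmetric] A[OF z] by simp
  also have "\<dots> = (deriv P z - (P z)\<^sup>2 / 2)
     + cnj (\<omega> z) / k z * (P z * deriv \<omega> z - deriv (deriv \<omega>) z)
     - 3 / 2 * (deriv \<omega> z * cnj (\<omega> z) / k z)\<^sup>2"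
    unfolding A_def
    by (simp only: divide_inverse power2_eq_square inverse_mult_distrib) (simp add: algebra_simps)
  finally show ?thesis unfolding k_real .
qed

end

theory Submission
  imports Defs
begin

text \<open>With \<open>P = h'' / h'\<close>, \<open>K = \<gamma> cos \<theta>\<close> and \<open>k = K e\<^bsup>-\<i>\<theta>\<^esup>\<close>, the defining inequality means that
  \<open>P = - k \<psi> / (1 - z \<psi>)\<close> for some holomorphic \<open>\<psi>\<close> with \<open>|\<psi>| \<le> 1\<close>. Then
  \<open>P' - P\<^sup>2 / 2 = - k (\<psi>' + (1 + k / 2) \<psi>\<^sup>2) / (1 - z \<psi>)\<^sup>2\<close>, which Schwarz-Pick bounds by
  \<open>4 K |1 + k / 2|\<close> in the weighted norm, and the square root in the theorem is \<open>2 |1 + k / 2|\<close>.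
  An automorphism \<open>\<omega>\<close> attains equality in Schwarz-Pick, so the weight cancels in the terms
  containing \<open>\<omega>\<close>: those with \<open>P \<omega>'\<close>, \<open>\<omega>''\<close> and \<open>\<omega>'\<^sup>2\<close> are at most \<open>2 K\<close>, \<open>4\<close> and \<open>3 / 2\<close>.\<close>

section \<open>Lower bounds for |1 - a z|\<close>

lemma one_minus_mult_nonzero:
  fixes a z :: complex
  assumes "cmod a \<le> 1" "cmod z < 1"
  shows "1 - a * z \<noteq> 0"
proof
  assume "1 - a * z = 0"
  then have "cmod a * cmod z = 1"
    by (metis norm_mult norm_one right_minus_eq)
  moreover have "cmod a * cmod z \<le> 1 * cmod z"
    using assms by (intro mult_right_mono) auto
  ultimately show False using assms by simp
qed

lemma one_minus_norm_mult_le: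
  fixes a z :: complex
  assumes "cmod a \<le> s" "cmod z \<le> r"
  shows "1 - s * r \<le> cmod (1 - a * z)"
proof -
  have "cmod (a * z) \<le> s * r"
    unfolding norm_mult using assms by (intro mult_mono) (auto intro: order_trans[OF norm_ge_zero])
  then show ?thesis
    using norm_triangle_ineq2[of 1 "a * z"] by simp
qed

section \<open>Derivatives of disk automorphisms\<close>

lemma Moebius_function_has_field_derivative:
  assumes "cmod a < 1" "cmod z < 1"
  shows "(Moebius_function t a has_field_derivative
           exp (\<i> * of_real t) * (1 - a * cnj a) / (1 - cnj a * z)\<^sup>2) (at z)"
proof -
  have "1 - cnj a * z \<noteq> 0"
    using assms by (intro one_minus_mult_nonzero) auto
  then show ?thesis
    unfolding Moebius_function_def
    by (auto intro!: derivative_eq_intros simp: divide_simps power2_eq_square algebra_simps)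
qed

text \<open>Factoring out the first derivative gives \<open>\<omega>''\<close> the same factor
  \<open>\<omega>'\<close> as the other dilatation terms of the Schwarzian.\<close>

lemma deriv_deriv_Moebius_function:
  assumes "cmod a < 1" "cmod z < 1"
  shows "deriv (deriv (Moebius_function t a)) z =
           deriv (Moebius_function t a) z * (2 * cnj a / (1 - cnj a * z))"
proof -
  have nz: "1 - cnj a * z \<noteq> 0"
    using assms by (intro one_minus_mult_nonzero) auto
  let ?c = "exp (\<i> * of_real t) * (1 - a * cnj a)"
  have "((\<lambda>w. ?c / (1 - cnj a * w)\<^sup>2) has_field_derivative
          ?c / (1 - cnj a * z)\<^sup>2 * (2 * cnj a / (1 - cnj a * z))) (at z)"
    using nz
    by (auto intro!: derivative_eq_intros simp: divide_simps power2_eq_square power4_eq_xxxx mult.assoc)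
  moreover have "deriv (Moebius_function t a) w = ?c / (1 - cnj a * w)\<^sup>2" if "w \<in> ball 0 1" for w
    using DERIV_imp_deriv[OF Moebius_function_has_field_derivative] assms that by auto
  ultimately show ?thesis
    using assms
    by (intro DERIV_imp_deriv)
      (auto intro: has_field_derivative_transform_within_open[where S = "ball 0 1"])
qed

text \<open>This rests on |1 - cnj a z|^2 - |z - a|^2 = (1 - |a|^2) (1 - |z|^2), divided by |1 - cnj
  a z|^2.\<close>

lemma one_minus_norm_Moebius_function:
  assumes "cmod a < 1" "cmod z < 1"
  shows "1 - (cmod (Moebius_function t a z))\<^sup>2 =
           (1 - (cmod a)\<^sup>2) * (1 - (cmod z)\<^sup>2) / (cmod (1 - cnj a * z))\<^sup>2"
proof -
  have "1 - cnj a * z \<noteq> 0"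
    using assms by (intro one_minus_mult_nonzero) auto
  then have pos: "(cmod (1 - cnj a * z))\<^sup>2 \<noteq> 0" by simp
  have "(cmod (1 - cnj a * z))\<^sup>2 - (cmod (z - a))\<^sup>2 = (1 - (cmod a)\<^sup>2) * (1 - (cmod z)\<^sup>2)"
    unfolding cmod_power2 by (simp add: power2_eq_square algebra_simps)
  moreover have "(cmod (Moebius_function t a z))\<^sup>2 = (cmod (z - a))\<^sup>2 / (cmod (1 - cnj a * z))\<^sup>2"
    by (simp add: Moebius_function_def norm_mult norm_divide power_divide)
  ultimately show ?thesis
    using pos by (simp only: diff_divide_distrib[symmetric] eq_divide_eq left_diff_distrib) simp
qed

text \<open>Equality in Schwarz-Pick: the derivative has modulus (1 - |a|^2) / |1 - cnj a z|^2, so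
  both sides are the quotient from the preceding lemma.\<close>

lemma norm_deriv_Moebius_function:
  assumes "cmod a < 1" "cmod z < 1"
  shows "cmod (deriv (Moebius_function t a) z) * (1 - (cmod z)\<^sup>2) =
           1 - (cmod (Moebius_function t a z))\<^sup>2"
proof -
  have "1 - a * cnj a = of_real (1 - (cmod a)\<^sup>2)"
    by (simp add: complex_norm_square del: of_real_power)
  moreover have "(cmod a)\<^sup>2 \<le> 1"
    using assms by (simp add: power_le_one)
  ultimately have "cmod (1 - a * cnj a) = 1 - (cmod a)\<^sup>2"
    by (simp only: norm_of_real)
  then show ?thesis
    unfolding one_minus_norm_Moebius_function[OF assms]
      DERIV_imp_deriv[OF Moebius_function_has_field_derivative[OF assms]]
    by (simp add: norm_mult norm_divide norm_power)
qed

section \<open>Consequences of the Schwarz lemma: Schwarz-Pick and the half-plane condition\<close>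

text \<open>Composing \<open>F\<close> with an automorphism taking 0 to \<open>a\<close> and one
  taking \<open>F a\<close> to 0 gives a self-map \<open>G\<close> of the disk fixing 0, to which
  the Schwarz lemma applies.\<close>

lemma Schwarz_Pick_strict:
  assumes hol: "F holomorphic_on ball 0 1"
    and lt: "\<And>z. cmod z < 1 \<Longrightarrow> cmod (F z) < 1"
    and a: "cmod a < 1"
  shows "cmod (deriv F a) * (1 - (cmod a)\<^sup>2) \<le> 1 - (cmod (F a))\<^sup>2"
proof -
  let ?M = "Moebius_function 0"
  define G where "G = (\<lambda>z. ?M (F a) (F (?M (- a) z)))"
  have ma: "cmod (?M (- a) z) < 1" if "cmod z < 1" for z
    using Moebius_function_norm_lt_1 a that by simp
  have Gd: "(G has_field_derivative deriv (?M (F a)) (F (?M (- a) z)) *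
      (deriv F (?M (- a) z) * deriv (?M (- a)) z)) (at z)" if z: "cmod z < 1" for z
  proof -
    have 1: "(?M (- a) has_field_derivative deriv (?M (- a)) z) (at z)"
      using Moebius_function_has_field_derivative[of "- a" z] a z
      by (metis DERIV_imp_deriv norm_minus_cancel)
    have 2: "(F has_field_derivative deriv F (?M (- a) z)) (at (?M (- a) z))"
      using ma[OF z] by (intro holomorphic_derivI[OF hol open_ball]) simp
    have 3: "(?M (F a) has_field_derivative deriv (?M (F a)) (F (?M (- a) z))) (at (F (?M (- a) z)))"
      using Moebius_function_has_field_derivative[OF lt[OF a] lt[OF ma[OF z]]]
      by (metis DERIV_imp_deriv)
    show ?thesis
      unfolding G_def using DERIV_chain2[OF 3 DERIV_chain2[OF 2 1]] by simp
  qed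
  have holG: "G holomorphic_on ball 0 1"
    unfolding holomorphic_on_def field_differentiable_def
    using Gd by (meson has_field_derivative_at_within mem_ball_0)
  have m0: "?M (- a) 0 = a" by (simp add: Moebius_function_of_zero)
  have "cmod (deriv G 0) \<le> 1"
  proof (rule Schwarz_Lemma(2)[OF holG _ _, of 0])
    show "G 0 = 0" by (simp add: G_def m0 Moebius_function_eq_zero)
    show "cmod (G z) < 1" if "cmod z < 1" for z
      unfolding G_def using Moebius_function_norm_lt_1 lt a ma that by simp
  qed auto
  moreover have "deriv G 0 = deriv (?M (F a)) (F a) * (deriv F a * deriv (?M (- a)) 0)"
    using DERIV_imp_deriv[OF Gd[of 0]] by (simp add: m0)
  \<comment> \<open>Schwarz-Pick equality for the two automorphisms, at 0 and at \<open>F a\<close>,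
    evaluates the outer factors of the chain rule.\<close>
  moreover have "cmod (deriv (?M (- a)) 0) = 1 - (cmod a)\<^sup>2"
    using norm_deriv_Moebius_function[of "- a" 0 0] a by (simp add: m0)
  moreover have "cmod (deriv (?M (F a)) (F a)) * (1 - (cmod (F a))\<^sup>2) = 1"
    using norm_deriv_Moebius_function[of "F a" "F a" 0] lt[OF a] by (simp add: Moebius_function_eq_zero)
  moreover have "0 < 1 - (cmod (F a))\<^sup>2"
    using lt[OF a] by (simp add: power_less_one_iff)
  ultimately have "cmod (deriv F a) * (1 - (cmod a)\<^sup>2)
      = cmod (deriv G 0) * (1 - (cmod (F a))\<^sup>2)"
    by (simp add: norm_mult)
  also have "\<dots> \<le> 1 * (1 - (cmod (F a))\<^sup>2)"
    using \<open>cmod (deriv G 0) \<le> 1\<close> \<open>0 < 1 - (cmod (F a))\<^sup>2\<close> by (intro mult_right_mono) auto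
  finally show ?thesis by simp
qed

text \<open>For \<open>\<psi>\<close> below only the weak bound is available. The strict version
  applies to \<open>t * F\<close> with 0 < t < 1, and t tends to 1.\<close>

lemma Schwarz_Pick:
  assumes hol: "F holomorphic_on ball 0 1"
    and le: "\<And>z. cmod z < 1 \<Longrightarrow> cmod (F z) \<le> 1"
    and a: "cmod a < 1"
  shows "cmod (deriv F a) * (1 - (cmod a)\<^sup>2) \<le> 1 - (cmod (F a))\<^sup>2"
proof -
  have scaled: "t * (cmod (deriv F a) * (1 - (cmod a)\<^sup>2)) \<le> 1 - (t * cmod (F a))\<^sup>2"
    if t: "0 < t" "t < 1" for t :: real
  proof -
    have "cmod (of_real t * F z) < 1" if "cmod z < 1" for z
    proof -
      have "t * cmod (F z) \<le> t * 1"
        using le[OF that] t by (intro mult_left_mono) auto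
      then have "t * cmod (F z) < 1" using t by linarith
      then show ?thesis using t by (simp add: norm_mult)
    qed
    moreover have "(\<lambda>z. of_real t * F z) holomorphic_on ball 0 1"
      using hol by (intro holomorphic_intros)
    moreover have "deriv (\<lambda>z. of_real t * F z) a = of_real t * deriv F a"
      using holomorphic_on_imp_differentiable_at[OF hol open_ball] a
      by (intro deriv_cmult) auto
    ultimately show ?thesis
      using Schwarz_Pick_strict[of "\<lambda>z. of_real t * F z" a] a t
      by (simp add: norm_mult mult.assoc)
  qed
  have "1 * (cmod (deriv F a) * (1 - (cmod a)\<^sup>2)) \<le> 1 - (1 * cmod (F a))\<^sup>2"
  proof (rule tendsto_le[of "at_left (1::real)"])
    show "((\<lambda>t. 1 - (t * cmod (F a))\<^sup>2) \<longlongrightarrow> 1 - (1 * cmod (F a))\<^sup>2) (at_left 1)"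
      by (intro tendsto_intros)
    show "((\<lambda>t. t * (cmod (deriv F a) * (1 - (cmod a)\<^sup>2))) \<longlongrightarrow>
        1 * (cmod (deriv F a) * (1 - (cmod a)\<^sup>2))) (at_left 1)"
      by (intro tendsto_intros)
    show "\<forall>\<^sub>F t in at_left 1. t * (cmod (deriv F a) * (1 - (cmod a)\<^sup>2)) \<le> 1 - (t * cmod (F a))\<^sup>2"
      using eventually_at_left_real[of 0 "1::real"] by (rule eventually_mono) (use scaled in auto)
  qed simp
  then show ?thesis by simp
qed

text \<open>\<open>w \<mapsto> w / (w - K)\<close> maps the half-plane \<open>Re w < K / 2\<close> into the disk, so the Schwarz lemma
  applies to \<open>e\<^bsup>\<i>\<theta>\<^esup> z P(z)\<close> followed by it; \<open>\<psi>\<close> is the result divided by \<open>z\<close>.\<close>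

lemma half_plane_representation:
  fixes P :: "complex \<Rightarrow> complex" and K :: real and u :: complex
  assumes hol: "P holomorphic_on ball 0 1" and "K > 0" and u: "cmod u = 1"
    and Re: "\<And>z. cmod z < 1 \<Longrightarrow> Re (u * (z * P z)) < K / 2"
  obtains \<psi> where "\<psi> holomorphic_on ball 0 1" "\<And>z. cmod z < 1 \<Longrightarrow> cmod (\<psi> z) \<le> 1"
    "\<And>z. cmod z < 1 \<Longrightarrow> P z = - (of_real K / u) * \<psi> z / (1 - z * \<psi> z)"
proof
  define Q where "Q = (\<lambda>z. u * (z * P z))"
  define \<psi> where "\<psi> = (\<lambda>z. u * P z / (Q z - of_real K))"
  define \<phi> where "\<phi> = (\<lambda>z. z * \<psi> z)"
  have nz: "Q z - of_real K \<noteq> 0" if "cmod z < 1" for z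
  proof
    assume "Q z - of_real K = 0"
    then have "Re (Q z) = K" by simp
    then show False using Re[OF that] \<open>K > 0\<close> unfolding Q_def by linarith
  qed
  show hol\<psi>: "\<psi> holomorphic_on ball 0 1"
    unfolding \<psi>_def using nz hol by (auto simp: Q_def intro!: holomorphic_intros)
  then have hol\<phi>: "\<phi> holomorphic_on ball 0 1"
    unfolding \<phi>_def by (intro holomorphic_intros)
  have \<phi>_lt: "cmod (\<phi> z) < 1" if z: "cmod z < 1" for z
  proof -
    \<comment> \<open>Points to the left of the line Re w = K / 2 are closer to 0 than to its mirror
      image \<open>K\<close>.\<close>
    have "(cmod (Q z))\<^sup>2 < (cmod (Q z - of_real K))\<^sup>2"
    proof -
      have "(cmod (Q z - of_real K))\<^sup>2 = (cmod (Q z))\<^sup>2 + 2 * K * (K / 2 - Re (Q z))"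
        unfolding cmod_power2 by (simp add: power2_eq_square algebra_simps)
      moreover have "0 < 2 * K * (K / 2 - Re (Q z))"
        using Re[OF z] \<open>K > 0\<close> unfolding Q_def by (intro mult_pos_pos) linarith+
      ultimately show ?thesis by linarith
    qed
    then have "cmod (Q z) < cmod (Q z - of_real K)"
      by (rule power_less_imp_less_base) simp
    moreover have "\<phi> z = Q z / (Q z - of_real K)"
      by (simp add: \<phi>_def \<psi>_def Q_def)
    ultimately show ?thesis
      using nz[OF z] by (simp add: norm_divide)
  qed
  have "\<phi> 0 = 0" by (simp add: \<phi>_def)
  note Schwarz = Schwarz_Lemma[OF hol\<phi> this \<phi>_lt]
  show "cmod (\<psi> z) \<le> 1" if z: "cmod z < 1" for z
  proof (cases "z = 0")
    case True
    \<comment> \<open>At 0 one cannot divide by \<open>z\<close>, but \<open>\<psi> 0\<close> is the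
      derivative of \<open>\<phi>\<close> there, which the Schwarz lemma bounds too.\<close>
    have "(\<phi> has_field_derivative \<psi> 0) (at 0)"
      using DERIV_mult[OF DERIV_ident holomorphic_derivI[OF hol\<psi> open_ball, of 0]]
      by (simp add: \<phi>_def)
    then show ?thesis
      using Schwarz(2)[of 0] True by (simp add: DERIV_imp_deriv)
  next
    case False
    have "cmod z * cmod (\<psi> z) \<le> cmod z * 1"
      using Schwarz(1)[OF _ z] by (simp add: \<phi>_def norm_mult)
    then show ?thesis
      using False by (simp add: mult_le_cancel_left_pos)
  qed
  show "P z = - (of_real K / u) * \<psi> z / (1 - z * \<psi> z)" if z: "cmod z < 1" for z
  proof -
    \<comment> \<open>Dividing \<open>\<psi> z\<close> by this cancels \<open>Q z - K\<close> and
      leaves \<open>- u * P z / K\<close>, which is then solved for \<open>P z\<close>.\<close>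
    have "1 - z * \<psi> z = - of_real K / (Q z - of_real K)"
      using nz[OF z] by (simp add: \<psi>_def Q_def divide_simps)
    moreover have "u \<noteq> 0" using u by auto
    ultimately show ?thesis
      using nz[OF z] \<open>K > 0\<close> by (simp add: \<psi>_def)
  qed
qed

section \<open>Weighted bounds for the analytic part\<close>

text \<open>With r = |z| and s = |\<open>\<psi> z\<close>|, one factor 1 - r^2 is spent on
  Schwarz-Pick and leaves a multiple of (1 - r s) (1 + r s). The other satisfies (1 - r^2) (1 + r s)
  \<le> 4 (1 - r s), and the resulting (1 - r s)^2 is at most the squared modulus of the
  denominator.\<close>

lemma analytic_schwarzian_bound:
  fixes P \<psi> :: "complex \<Rightarrow> complex" and k :: complex
  assumes hol: "\<psi> holomorphic_on ball 0 1"
    and le: "\<And>z. cmod z < 1 \<Longrightarrow> cmod (\<psi> z) \<le> 1"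
    and P: "\<And>z. cmod z < 1 \<Longrightarrow> P z = - k * \<psi> z / (1 - z * \<psi> z)"
    and k: "cmod (1 + k / 2) \<ge> 1"
    and z: "cmod z < 1"
  shows "(1 - (cmod z)\<^sup>2)\<^sup>2 * cmod (deriv P z - (P z)\<^sup>2 / 2) \<le> 4 * cmod k * cmod (1 + k / 2)"
proof -
  define r s where "r = cmod z" and "s = cmod (\<psi> z)"
  have r: "0 \<le> r" "r < 1" and s: "0 \<le> s" "s \<le> 1"
    using z le[OF z] by (auto simp: r_def s_def)
  have rs: "r * s \<le> r" using r s by (simp add: mult_left_le)
  define d where "d = 1 - z * \<psi> z"
  have d: "d \<noteq> 0" and d_ge: "1 - r * s \<le> cmod d"
    using one_minus_mult_nonzero[OF le[OF z] z] one_minus_norm_mult_le[of z r "\<psi> z" s]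
    by (auto simp: d_def r_def s_def mult.commute)
  \<comment> \<open>In the quotient rule the terms with \<open>z * \<psi> z * deriv \<psi> z\<close>
    cancel.\<close>
  have "((\<lambda>w. - k * \<psi> w / (1 - w * \<psi> w)) has_field_derivative
      - k * (deriv \<psi> z + (\<psi> z)\<^sup>2) / d\<^sup>2) (at z)"
    using holomorphic_derivI[OF hol open_ball, of z] z d unfolding d_def
    by (auto intro!: derivative_eq_intros simp: divide_simps) (simp add: power2_eq_square algebra_simps)
  then have "(P has_field_derivative - k * (deriv \<psi> z + (\<psi> z)\<^sup>2) / d\<^sup>2) (at z)"
    using z P by (auto intro: has_field_derivative_transform_within_open[where S = "ball 0 1"])
  then have "deriv P z - (P z)\<^sup>2 / 2 = - k * (deriv \<psi> z + (1 + k / 2) * (\<psi> z)\<^sup>2) / d\<^sup>2"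
    using d unfolding P[OF z] d_def[symmetric]
    by (simp add: DERIV_imp_deriv divide_simps power2_eq_square algebra_simps)
  then have eq: "cmod (deriv P z - (P z)\<^sup>2 / 2) =
      cmod k * (cmod (deriv \<psi> z + (1 + k / 2) * (\<psi> z)\<^sup>2) / (cmod d)\<^sup>2)"
    by (simp add: norm_mult norm_divide norm_power)
  define l where "l = cmod (1 + k / 2)"
  have "(1 - r\<^sup>2) * cmod (deriv \<psi> z + (1 + k / 2) * (\<psi> z)\<^sup>2)
      \<le> (1 - r\<^sup>2) * (cmod (deriv \<psi> z) + l * s\<^sup>2)"
    using norm_triangle_ineq[of "deriv \<psi> z" "(1 + k / 2) * (\<psi> z)\<^sup>2"] r
    by (intro mult_left_mono) (auto simp: l_def s_def norm_mult norm_power power_le_one)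
  also have "\<dots> \<le> (1 - s\<^sup>2) + (1 - r\<^sup>2) * (l * s\<^sup>2)"
    using Schwarz_Pick[OF hol le z] by (simp add: r_def s_def algebra_simps)
  \<comment> \<open>Since \<open>l \<ge> 1\<close>, both summands can carry the factor
    \<open>l\<close>; their sum then collapses to l (1 - r^2 s^2).\<close>
  also have "\<dots> \<le> l * (1 - s\<^sup>2) + (1 - r\<^sup>2) * (l * s\<^sup>2)"
    using k s mult_right_mono[of 1 l "1 - s\<^sup>2"] by (simp add: l_def power_le_one)
  also have "\<dots> = l * ((1 - r * s) * (1 + r * s))"
    by (simp add: power2_eq_square algebra_simps)
  finally have num: "(1 - r\<^sup>2) * cmod (deriv \<psi> z + (1 + k / 2) * (\<psi> z)\<^sup>2) \<le> l * ((1 - r * s) * (1 + r * s))" .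
  have l: "l \<ge> 1" using k by (simp add: l_def)
  have rs1: "0 < 1 - r * s" and rs0: "0 \<le> r * s" using rs r s by auto
  have "(1 - r\<^sup>2) * (l * ((1 - r * s) * (1 + r * s))) = l * (1 - r * s) * ((1 - r\<^sup>2) * (1 + r * s))"
    by simp
  also have "\<dots> \<le> l * (1 - r * s) * (4 * (1 - r * s))"
  proof (intro mult_left_mono)
    have "(1 - r\<^sup>2) * (1 + r * s) = (1 - r) * ((1 + r) * (1 + r * s))"
      by (simp add: power2_eq_square algebra_simps)
    \<comment> \<open>The constant 4 arises here: r s \<le> r handles the first factor, and the
      other two are at most 2.\<close>
    also have "\<dots> \<le> (1 - r * s) * (2 * 2)"
      using r rs rs0 by (intro mult_mono) auto
    finally show "(1 - r\<^sup>2) * (1 + r * s) \<le> 4 * (1 - r * s)" by simp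
  qed (use l rs1 in auto)
  also have "\<dots> = 4 * l * (1 - r * s)\<^sup>2" by (simp add: power2_eq_square)
  also have "\<dots> \<le> 4 * l * (cmod d)\<^sup>2"
    using d_ge rs1 l by (intro mult_left_mono power_mono) auto
  finally have "(1 - r\<^sup>2) * ((1 - r\<^sup>2) * cmod (deriv \<psi> z + (1 + k / 2) * (\<psi> z)\<^sup>2)) \<le> 4 * l * (cmod d)\<^sup>2"
    using mult_left_mono[OF num, of "1 - r\<^sup>2"] r by (simp add: power_le_one)
  then have "(1 - r\<^sup>2)\<^sup>2 * (cmod (deriv \<psi> z + (1 + k / 2) * (\<psi> z)\<^sup>2) / (cmod d)\<^sup>2) \<le> 4 * l"
    using d by (simp add: divide_simps power2_eq_square mult.assoc)
  then have "cmod k * ((1 - r\<^sup>2)\<^sup>2 * (cmod (deriv \<psi> z + (1 + k / 2) * (\<psi> z)\<^sup>2) / (cmod d)\<^sup>2))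
      \<le> cmod k * (4 * l)"
    by (rule mult_left_mono) simp
  then show ?thesis
    unfolding eq l_def r_def by (simp only: mult_ac)
qed

text \<open>Here 1 - |z|^2 = (1 + |z|) (1 - |z|) and the denominator is at least 1 - |z|. It serves
  for \<open>P\<close> with \<open>a = \<psi> z\<close> and for the logarithmic derivative of
  \<open>\<omega>'\<close> with \<open>a = cnj \<alpha>\<close>.\<close>

lemma one_minus_square_div_le:
  fixes a z :: complex
  assumes "cmod a \<le> 1" "cmod z < 1"
  shows "(1 - (cmod z)\<^sup>2) * (cmod a / cmod (1 - a * z)) \<le> 2"
proof -
  define r where "r = cmod z"
  have r: "0 \<le> r" "r < 1" using assms by (auto simp: r_def)
  have "1 - r \<le> cmod (1 - a * z)"
    using one_minus_norm_mult_le[of a 1 z r] assms by (simp add: r_def)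
  then have "(1 + r) * (1 - r) \<le> 2 * cmod (1 - a * z)"
    using r by (intro mult_mono) auto
  moreover have "(1 - r\<^sup>2) * cmod a \<le> (1 - r\<^sup>2) * 1"
    using assms r by (intro mult_left_mono) (auto simp: power_le_one)
  moreover have "(1 - r\<^sup>2) * 1 = (1 + r) * (1 - r)"
    by (simp add: power2_eq_square algebra_simps)
  ultimately have "(1 - r\<^sup>2) * cmod a \<le> 2 * cmod (1 - a * z)"
    by (metis order_trans)
  then show ?thesis
    using one_minus_mult_nonzero[OF assms] by (simp add: r_def divide_simps)
qed

section \<open>The Schwarzian norm of a mapping in \<open>HC\<close>\<close>

theorem theorem2p4:
  fixes \<theta> \<gamma> :: real and f :: "complex \<Rightarrow> complex"
  assumes "\<bar>\<theta>\<bar> < pi / 2"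
    and "\<gamma> > 0"
    and "f \<in> HC \<theta> \<gamma>"
  shows "schwarzian_norm f \<le>
    ereal (2 * \<gamma> * cos \<theta> * sqrt (4 + (\<gamma>\<^sup>2 + 4 * \<gamma>) * (cos \<theta>)\<^sup>2) + 2 * \<gamma> * cos \<theta> + 11 / 2)"
proof -
  obtain h g where dec: "harmonic_decomp f h g"
    and h_nz: "\<And>z. z \<in> unit_disk \<Longrightarrow> deriv h z \<noteq> 0"
    and Re: "\<And>z. z \<in> unit_disk \<Longrightarrow>
        Re (exp (\<i> * of_real \<theta>) * (1 + z * deriv (deriv h) z / deriv h z)) < (1 + \<gamma> / 2) * cos \<theta>"
    and aut: "(\<lambda>z. deriv g z / deriv h z) \<in> disk_automorphisms"
    using assms(3) unfolding HC_def by blast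
  define \<omega> where "\<omega> = (\<lambda>z. deriv g z / deriv h z)"
  obtain \<alpha> t where \<alpha>: "cmod \<alpha> < 1" and \<omega>M: "\<And>z. z \<in> unit_disk \<Longrightarrow> \<omega> z = Moebius_function t \<alpha> z"
    using aut unfolding disk_automorphisms_def \<omega>_def by auto
  let ?M = "Moebius_function t \<alpha>"
  \<comment> \<open>The dilatation is known to be an automorphism only on the disk; openness carries
    the equality over to derivatives.\<close>
  have d\<omega>: "deriv \<omega> z = deriv ?M z" if "z \<in> unit_disk" for z
    using that \<omega>M eventually_nhds_in_open[OF open_ball that]
    by (intro deriv_cong_ev) (auto elim: eventually_mono)
  have dd\<omega>: "deriv (deriv \<omega>) z = deriv (deriv ?M) z" if "z \<in> unit_disk" for z
    using that d\<omega> eventually_nhds_in_open[OF open_ball that]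
    by (intro deriv_cong_ev) (auto elim: eventually_mono)
  have \<omega>_less: "cmod (\<omega> z) < 1" if "z \<in> unit_disk" for z
    using \<omega>M[OF that] Moebius_function_norm_lt_1 \<alpha> that by simp

  define P where "P = (\<lambda>z. deriv (deriv h) z / deriv h z)"
  have "h holomorphic_on unit_disk" using dec by (simp add: harmonic_decomp_def)
  then have holP: "P holomorphic_on ball 0 1"
    unfolding P_def using h_nz by (intro holomorphic_intros) auto
  define K where "K = \<gamma> * cos \<theta>"
  have "cos \<theta> > 0" using assms(1) by (intro cos_gt_zero_pi) auto
  then have "K > 0" using assms(2) by (simp add: K_def)
  define u where "u = exp (\<i> * complex_of_real \<theta>)"
  have u: "cmod u = 1" by (simp add: u_def)
  have Re_u: "Re u = cos \<theta>" by (simp add: u_def Re_exp)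
  have "Re (u * (z * P z)) < K / 2" if "cmod z < 1" for z
  proof -
    \<comment> \<open>The summand 1 contributes Re u = cos \<theta>, which leaves exactly
      \<open>K / 2\<close> of the bound.\<close>
    have "u * (1 + z * deriv (deriv h) z / deriv h z) = u + u * (z * P z)"
      by (simp add: P_def algebra_simps)
    then have "Re u + Re (u * (z * P z)) < (1 + \<gamma> / 2) * cos \<theta>"
      using Re[of z] that by (simp add: u_def)
    then show ?thesis using Re_u by (simp add: K_def algebra_simps)
  qed
  then obtain \<psi> where hol\<psi>: "\<psi> holomorphic_on ball 0 1"
    and \<psi>_le: "\<And>z. cmod z < 1 \<Longrightarrow> cmod (\<psi> z) \<le> 1"
    and P\<psi>: "\<And>z. cmod z < 1 \<Longrightarrow> P z = - (of_real K / u) * \<psi> z / (1 - z * \<psi> z)"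
    using half_plane_representation[OF holP \<open>K > 0\<close> u] by blast
  define k where "k = of_real K / u"
  have norm_k: "cmod k = K" using u \<open>K > 0\<close> by (simp add: k_def norm_divide)
  \<comment> \<open>As |u| = 1, this gives Re k = K cos \<theta>, hence |1 + k/2|^2 = 1 + K cos
    \<theta> + K^2/4, a quarter of the radicand.\<close>
  have "k = of_real K * cnj u"
    using u by (simp add: k_def divide_conv_cnj)
  then have "(cmod (1 + k / 2))\<^sup>2 = 1 + K * cos \<theta> + (K / 2)\<^sup>2 * (cmod u)\<^sup>2"
    unfolding cmod_power2 Re_u[symmetric] by (simp add: power2_eq_square algebra_simps)
  then have sq: "(cmod (1 + k / 2))\<^sup>2 = (4 + (\<gamma>\<^sup>2 + 4 * \<gamma>) * (cos \<theta>)\<^sup>2) / 4"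
    by (simp add: u K_def power2_eq_square algebra_simps)
  then have norm_l: "2 * cmod (1 + k / 2) = sqrt (4 + (\<gamma>\<^sup>2 + 4 * \<gamma>) * (cos \<theta>)\<^sup>2)"
    by (intro real_sqrt_unique[symmetric]) (auto simp: power_mult_distrib)
  have "1\<^sup>2 \<le> (cmod (1 + k / 2))\<^sup>2" using assms(2) unfolding sq by simp
  then have k_ge: "1 \<le> cmod (1 + k / 2)" by (rule power2_le_imp_le) simp

  have bound: "(1 - (cmod z)\<^sup>2)\<^sup>2 * cmod (schwarzian f z) \<le>
      2 * \<gamma> * cos \<theta> * sqrt (4 + (\<gamma>\<^sup>2 + 4 * \<gamma>) * (cos \<theta>)\<^sup>2) + 2 * \<gamma> * cos \<theta> + 11 / 2"
    if zin: "z \<in> unit_disk" for z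
  proof -
    from zin have z: "cmod z < 1" by simp
    define R where "R = 1 - (cmod z)\<^sup>2"
    define k0 where "k0 = 1 - (cmod (\<omega> z))\<^sup>2"
    have R: "0 < R" using z by (simp add: R_def power_less_one_iff)
    have k0: "0 < k0" using \<omega>_less[OF zin] by (simp add: k0_def power_less_one_iff)
    have SP: "cmod (deriv \<omega> z) * R = k0"
      using norm_deriv_Moebius_function[OF \<alpha> z, of t] by (simp add: R_def k0_def d\<omega>[OF zin] \<omega>M[OF zin])
    define b where "b = 2 * cnj \<alpha> / (1 - cnj \<alpha> * z)"
    have dd: "deriv (deriv \<omega>) z = deriv \<omega> z * b"
      unfolding b_def using deriv_deriv_Moebius_function[OF \<alpha> z] by (simp add: d\<omega>[OF zin] dd\<omega>[OF zin])
    define S where "S = deriv P z - (P z)\<^sup>2 / 2"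
    \<comment> \<open>Every dilatation term contains this factor: the Schwarzian is
      \<open>S + q * P z - q * b - 3 / 2 * q\<^sup>2\<close>. The weight \<open>R\<close> turns |q|
      into |\<open>\<omega> z\<close>|.\<close>
    define q where "q = deriv \<omega> z * cnj (\<omega> z) / of_real k0"
    have q: "R * cmod q \<le> 1"
    proof -
      have "R * cmod q = cmod (\<omega> z)"
        using SP k0 by (simp add: q_def norm_mult norm_divide field_simps)
      then show ?thesis using \<omega>_less[OF zin] by simp
    qed
    have "schwarzian f z = S + cnj (\<omega> z) / of_real k0 * (P z * deriv \<omega> z - deriv (deriv \<omega>) z)
        - 3 / 2 * q\<^sup>2"
      unfolding S_def q_def k0_def P_def
      by (rule schwarzian_eq[OF dec h_nz _ \<omega>_less zin]) (simp_all add: \<omega>_def)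
    also have "\<dots> = S + q * P z - q * b - 3 / 2 * q\<^sup>2"
      unfolding dd q_def by (simp add: algebra_simps)
    finally have "cmod (schwarzian f z) \<le>
        cmod S + cmod (q * P z) + cmod (q * b) + cmod (3 / 2 * q\<^sup>2)"
      by (auto intro!: order_trans[OF norm_triangle_ineq4] order_trans[OF norm_triangle_ineq] add_mono)
    then have "R\<^sup>2 * cmod (schwarzian f z) \<le> R\<^sup>2 * (cmod S + cmod (q * P z)
        + cmod (q * b) + cmod (3 / 2 * q\<^sup>2))"
      by (rule mult_left_mono) simp
    \<comment> \<open>In each product one \<open>R\<close> goes to each factor; the last two terms
      supply 4 + 3/2 = 11/2.\<close>
    also have "\<dots> = R\<^sup>2 * cmod S + (R * cmod q) * (R * cmod (P z))
        + (R * cmod q) * (R * cmod b) + 3 / 2 * (R * cmod q)\<^sup>2"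
      by (simp add: norm_mult norm_power power2_eq_square algebra_simps)
    also have "\<dots> \<le> 4 * K * cmod (1 + k / 2) + 1 * (2 * K) + 1 * 4 + 3 / 2 * 1"
    proof (intro add_mono)
      show "R\<^sup>2 * cmod S \<le> 4 * K * cmod (1 + k / 2)"
        using analytic_schwarzian_bound[OF hol\<psi> \<psi>_le P\<psi>[folded k_def] k_ge z]
        by (simp add: R_def S_def norm_k)
      have "K * (R * (cmod (\<psi> z) / cmod (1 - \<psi> z * z))) \<le> K * 2"
        unfolding R_def using one_minus_square_div_le[OF \<psi>_le[OF z] z] \<open>K > 0\<close>
        by (intro mult_left_mono) auto
      then have "R * cmod (P z) \<le> 2 * K"
        unfolding P\<psi>[OF z, folded k_def] by (simp add: norm_mult norm_divide norm_k mult_ac)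
      then show "(R * cmod q) * (R * cmod (P z)) \<le> 1 * (2 * K)"
        by (rule mult_mono[OF q]) (use R in auto)
      have "cmod b = 2 * (cmod (cnj \<alpha>) / cmod (1 - cnj \<alpha> * z))"
        by (simp add: b_def norm_mult norm_divide)
      then have "R * cmod b = 2 * (R * (cmod (cnj \<alpha>) / cmod (1 - cnj \<alpha> * z)))"
        by (simp only: mult.left_commute)
      then have "R * cmod b \<le> 4"
        using one_minus_square_div_le[of "cnj \<alpha>" z] \<alpha> z
        unfolding R_def by simp
      then show "(R * cmod q) * (R * cmod b) \<le> 1 * 4"
        by (rule mult_mono[OF q]) (use R in auto)
      show "3 / 2 * (R * cmod q)\<^sup>2 \<le> 3 / 2 * 1"
        using q R by (intro mult_left_mono) (auto simp: power_le_one)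
    qed
    also have "\<dots> = 2 * K * (2 * cmod (1 + k / 2)) + 2 * K + 11 / 2" by simp
    finally show ?thesis
      unfolding norm_l by (simp add: R_def K_def mult_ac)
  qed
  show ?thesis
    unfolding schwarzian_norm_def by (rule SUP_least) (use bound in simp)
qed

end
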